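(* Let $c$ be a real number and let $f\colon \mathcal{L}_2\to L_1[0,1]$ be a mapping satisfying $$d(a,b)\le \|f(a)-f(b)\|_1\le c\, d(a,b)\qquad\text{for all } a,b\in\mathcal{L}_2,$$ where $\mathcal{L}_2$ denotes (the vertex set of) the Laakso graph of level $2$ and $d$ is its shortest-path metric. Then $c\ge 9/8$.
   Context: Laakso graphs: $\mathcal{L}_1$ is the graph with six vertices $A,T,L,R,B,U$ and six edges $AT$, $TL$, $TR$, $LB$, $RB$, $BU$. $\mathcal{L}_2$ is obtained from $\mathcal{L}_1$ by replacing each edge $uv$ of $\mathcal{L}_1$ by a copy of $\mathcal{L}_1$, with $u$ and $v$ identified with the vertices $A$ and $U$ of the copy (the other four vertices of each copy being new; which endpoint plays the role of $A$ does not matter, up to isomorphism, by symmetry). Thus $\mathcal{L}_2$ has $30$ vertices. Every edge of $\mathcal{L}_2$ has length $1$, and $\mathcal{L}_2$ is regarded as a metric space on its vertex set with the shortest-path metric $d$. $L_1[0,1]$ is taken with respect to Lebesgue measure. *)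

theory Defs
  imports "HOL-Analysis.Analysis"
begin

datatype laakso1 = VA | VT | VL | VR | VB | VU

definition laakso1_arcs :: "(laakso1 \<times> laakso1) set" where
  "laakso1_arcs = {(VA, VT), (VT, VL), (VT, VR), (VL, VB), (VR, VB), (VB, VU)}"

text \<open>The four inner vertices of the copy of the level-1 graph that replaces the arc \<open>e\<close>
  are \<open>New e w\<close> for \<open>w \<in> {VT, VL, VR, VB}\<close>; its end vertices are the end
  points of \<open>e\<close>. Terms \<open>New e w\<close> not of this form are not vertices.\<close>

datatype laakso2 = Old laakso1 | New "laakso1 \<times> laakso1" laakso1

fun in_copy :: "laakso1 \<times> laakso1 \<Rightarrow> laakso1 \<Rightarrow> laakso2" where
  "in_copy (u, v) VA = Old u"
| "in_copy (u, v) VU = Old v"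
| "in_copy (u, v) w = New (u, v) w"

definition laakso2_verts :: "laakso2 set" where
  "laakso2_verts = (\<Union>e\<in>laakso1_arcs. range (in_copy e))"

definition laakso2_arcs :: "(laakso2 \<times> laakso2) set" where
  "laakso2_arcs = (\<Union>e\<in>laakso1_arcs. (\<lambda>(p, q). (in_copy e p, in_copy e q)) ` laakso1_arcs)"

text \<open>The orientation of the arcs only serves the substitution; the graph is undirected.\<close>

definition laakso2_adj :: "(laakso2 \<times> laakso2) set" where
  "laakso2_adj = laakso2_arcs \<union> laakso2_arcs\<inverse>"

text \<open>\<open>(a, b) \<in> laakso2_adj ^^ n\<close> says that there is a walk with \<open>n\<close> edges
  from \<open>a\<close> to \<open>b\<close>.\<close>

definition laakso2_dist :: "laakso2 \<Rightarrow> laakso2 \<Rightarrow> nat" where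
  "laakso2_dist a b = (LEAST n. (a, b) \<in> laakso2_adj ^^ n)"

text \<open>Elements of \<open>L\<^sub>1[0,1]\<close> are given by representatives. The norm depends only on
  the almost-everywhere class, so a map into the quotient is the same as a choice of
  representatives as far as norms of differences are concerned.\<close>

definition L1_unit :: "(real \<Rightarrow> real) set" where
  "L1_unit = {g. integrable (lebesgue_on {0..1}) g}"

definition L1_norm :: "(real \<Rightarrow> real) \<Rightarrow> real" where
  "L1_norm g = (\<integral>x. \<bar>g x\<bar> \<partial>lebesgue_on {0..1})"

lemma UNIV_laakso1: "(UNIV :: laakso1 set) = {VA, VT, VL, VR, VB, VU}"
proof -
  have "x \<in> {VA, VT, VL, VR, VB, VU}" for x
    by (cases x) auto
  then show ?thesis by blast
qed

lemma card_laakso2_verts: "card laakso2_verts = 30"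
  by (simp add: card_insert_if laakso2_verts_def laakso1_arcs_def UNIV_laakso1)

lemma card_laakso2_arcs: "card laakso2_arcs = 36"
  by (simp add: card_insert_if laakso2_arcs_def laakso1_arcs_def)

lemma laakso2_connected:
  assumes "a \<in> laakso2_verts" "b \<in> laakso2_verts"
  shows "\<exists>n. (a, b) \<in> laakso2_adj ^^ n"
proof -
  have sym: "(y, x) \<in> laakso2_adj\<^sup>*" if "(x, y) \<in> laakso2_adj\<^sup>*" for x y
    using that
    by (rule symD[OF sym_rtrancl, rotated])
      (auto simp: laakso2_adj_def sym_def)
  have step: "(in_copy e p, in_copy e q) \<in> laakso2_adj\<^sup>*"
    if "e \<in> laakso1_arcs" "(p, q) \<in> laakso1_arcs" for e p q
    using that by (force simp: laakso2_adj_def laakso2_arcs_def intro!: r_into_rtrancl)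
  have in_copy: "(in_copy e VA, in_copy e w) \<in> laakso2_adj\<^sup>*" if e: "e \<in> laakso1_arcs" for e w
  proof -
    have 1: "(in_copy e VA, in_copy e VT) \<in> laakso2_adj\<^sup>*"
      by (rule step[OF e]) (simp add: laakso1_arcs_def)
    have 2: "(in_copy e VA, in_copy e VL) \<in> laakso2_adj\<^sup>*"
      by (rule rtrancl_trans[OF 1 step[OF e]]) (simp add: laakso1_arcs_def)
    have 3: "(in_copy e VA, in_copy e VR) \<in> laakso2_adj\<^sup>*"
      by (rule rtrancl_trans[OF 1 step[OF e]]) (simp add: laakso1_arcs_def)
    have 4: "(in_copy e VA, in_copy e VB) \<in> laakso2_adj\<^sup>*"
      by (rule rtrancl_trans[OF 2 step[OF e]]) (simp add: laakso1_arcs_def)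
    have 5: "(in_copy e VA, in_copy e VU) \<in> laakso2_adj\<^sup>*"
      by (rule rtrancl_trans[OF 4 step[OF e]]) (simp add: laakso1_arcs_def)
    from 1 2 3 4 5 show ?thesis by (cases w) auto
  qed
  have old_step: "(Old u, Old v) \<in> laakso2_adj\<^sup>*" if "(u, v) \<in> laakso1_arcs" for u v
    using in_copy[OF that, of VU] by simp
  have old: "(Old VA, Old u) \<in> laakso2_adj\<^sup>*" for u
  proof -
    have 1: "(Old VA, Old VT) \<in> laakso2_adj\<^sup>*"
      by (rule old_step) (simp add: laakso1_arcs_def)
    have 2: "(Old VA, Old VL) \<in> laakso2_adj\<^sup>*"
      by (rule rtrancl_trans[OF 1 old_step]) (simp add: laakso1_arcs_def)
    have 3: "(Old VA, Old VR) \<in> laakso2_adj\<^sup>*"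
      by (rule rtrancl_trans[OF 1 old_step]) (simp add: laakso1_arcs_def)
    have 4: "(Old VA, Old VB) \<in> laakso2_adj\<^sup>*"
      by (rule rtrancl_trans[OF 2 old_step]) (simp add: laakso1_arcs_def)
    have 5: "(Old VA, Old VU) \<in> laakso2_adj\<^sup>*"
      by (rule rtrancl_trans[OF 4 old_step]) (simp add: laakso1_arcs_def)
    from 1 2 3 4 5 show ?thesis by (cases u) auto
  qed
  have root: "(Old VA, x) \<in> laakso2_adj\<^sup>*" if x: "x \<in> laakso2_verts" for x
  proof -
    obtain u v w where e: "(u, v) \<in> laakso1_arcs" and w: "x = in_copy (u, v) w"
      using x by (auto simp: laakso2_verts_def)
    show ?thesis
      using rtrancl_trans[OF old[of u]] in_copy[OF e, of w] w by simp
  qed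
  have "(a, b) \<in> laakso2_adj\<^sup>*"
    using rtrancl_trans[OF sym[OF root[OF assms(1)]] root[OF assms(2)]] .
  then show ?thesis by (rule rtrancl_imp_relpow)
qed

end

theory Submission
  imports Defs
begin

text \<open>Every inequality between sums of distances that holds for all cuts, that is for all
  \<open>0/1\<close>-valued functions, holds for distances in \<open>L\<^sub>1\<close>: real distances are mixtures of
  cut distances (layer cake), and \<open>L\<^sub>1\<close> distances are mixtures of real ones. We use such an
  inequality on the cycle of length 16 formed by the copies replacing \<open>TL\<close>, \<open>LB\<close>, \<open>BR\<close> and
  \<open>RT\<close>, each of which has two middle vertices. The four pairs of middle vertices of one copy
  (at distance 2) and the eight antipodal pairs of middle vertices (at distance 8) are
  bounded by twice the sum of the edges, where the edges at the ends of the copies, being shared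
  by two paths, count twice. In \<open>\<L>\<^sub>2\<close> the two sides are \<open>72\<close> and
  \<open>64\<close>, whence the bound \<open>72/64 = 9/8\<close>.\<close>

subsection \<open>Cut inequalities\<close>

lemma has_bochner_integral_sum_list:
  fixes g :: "'a \<Rightarrow> 'b \<Rightarrow> real"
  assumes "\<And>p. p \<in> set ps \<Longrightarrow> has_bochner_integral M (g p) (I p)"
  shows "has_bochner_integral M (\<lambda>t. \<Sum>p\<leftarrow>ps. g p t) (\<Sum>p\<leftarrow>ps. I p)"
  using assms by (induction ps) (auto intro: has_bochner_integral_add)

lemma has_bochner_integral_mono:
  fixes g h :: "'b \<Rightarrow> real"
  assumes "has_bochner_integral M g a" "has_bochner_integral M h b"
    and "\<And>t. t \<in> space M \<Longrightarrow> g t \<le> h t"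
  shows "a \<le> b"
  using assms integral_mono[of M g h]
  by (simp add: has_bochner_integral_iff)

text \<open>The thresholds t that separate x from y form a half-open interval of length \<bar>x -
  y\<bar>.\<close>

lemma has_bochner_integral_layer_cake:
  fixes x y :: real
  shows "has_bochner_integral lborel (\<lambda>t. \<bar>of_bool (t < x) - of_bool (t < y)\<bar>) \<bar>x - y\<bar>"
proof -
  have eq: "(\<lambda>t. \<bar>of_bool (t < x) - of_bool (t < y)\<bar>)
      = (indicator {min x y..<max x y} :: real \<Rightarrow> real)"
    by (auto simp: fun_eq_iff indicator_def)
  have "has_bochner_integral lborel (indicator {min x y..<max x y} :: real \<Rightarrow> real)
      (measure lborel {min x y..<max x y})"
    by (rule has_bochner_integral_real_indicator) auto
  moreover have "measure lborel {min x y..<max x y} = \<bar>x - y\<bar>"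
    by (auto simp: min_def max_def)
  ultimately show ?thesis unfolding eq by simp
qed

text \<open>For each threshold t the hypothesis applies to the cut
  \<open>s v = of_bool (t < x v)\<close>. Integration over t turns every cut distance into a real
  distance.\<close>

lemma cut_inequality_real:
  fixes x :: "'a \<Rightarrow> real"
  assumes cut: "\<And>s :: 'a \<Rightarrow> real. (\<And>v. s v \<in> {0, 1}) \<Longrightarrow>
      (\<Sum>(a, b)\<leftarrow>ps. \<bar>s a - s b\<bar>) \<le> m * (\<Sum>(a, b)\<leftarrow>qs. \<bar>s a - s b\<bar>)"
  shows "(\<Sum>(a, b)\<leftarrow>ps. \<bar>x a - x b\<bar>) \<le> m * (\<Sum>(a, b)\<leftarrow>qs. \<bar>x a - x b\<bar>)"
proof -
  have mix: "has_bochner_integral lborel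
      (\<lambda>t. \<Sum>(a, b)\<leftarrow>rs. \<bar>of_bool (t < x a) - of_bool (t < x b)\<bar>)
      (\<Sum>(a, b)\<leftarrow>rs. \<bar>x a - x b\<bar>)" for rs
    unfolding case_prod_beta'
    by (intro has_bochner_integral_sum_list has_bochner_integral_layer_cake)
  show ?thesis
    by (rule has_bochner_integral_mono[OF mix has_bochner_integral_mult_right[OF mix]])
      (auto intro: cut)
qed

text \<open>The real inequality holds at every t for the values \<open>f v t\<close>, and is then
  integrated over the unit interval.\<close>

lemma cut_inequality_L1:
  fixes f :: "'a \<Rightarrow> real \<Rightarrow> real"
  assumes cut: "\<And>s :: 'a \<Rightarrow> real. (\<And>v. s v \<in> {0, 1}) \<Longrightarrow>
      (\<Sum>(a, b)\<leftarrow>ps. \<bar>s a - s b\<bar>) \<le> m * (\<Sum>(a, b)\<leftarrow>qs. \<bar>s a - s b\<bar>)"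
    and f: "\<And>a b. (a, b) \<in> set ps \<union> set qs \<Longrightarrow> f a \<in> L1_unit \<and> f b \<in> L1_unit"
  shows "(\<Sum>(a, b)\<leftarrow>ps. L1_norm (\<lambda>t. f a t - f b t))
    \<le> m * (\<Sum>(a, b)\<leftarrow>qs. L1_norm (\<lambda>t. f a t - f b t))"
proof -
  have mix: "has_bochner_integral (lebesgue_on {0..1})
      (\<lambda>t. \<Sum>(a, b)\<leftarrow>rs. \<bar>f a t - f b t\<bar>) (\<Sum>(a, b)\<leftarrow>rs. L1_norm (\<lambda>t. f a t - f b t))"
    if "set rs \<subseteq> set ps \<union> set qs" for rs
    unfolding case_prod_beta'
  proof (rule has_bochner_integral_sum_list)
    fix p assume "p \<in> set rs"
    then have "f (fst p) \<in> L1_unit" "f (snd p) \<in> L1_unit"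
      using that f[of "fst p" "snd p"] by auto
    then show "has_bochner_integral (lebesgue_on {0..1}) (\<lambda>t. \<bar>f (fst p) t - f (snd p) t\<bar>)
        (L1_norm (\<lambda>t. f (fst p) t - f (snd p) t))"
      unfolding L1_norm_def L1_unit_def
      by (intro has_bochner_integral_integrable) auto
  qed
  show ?thesis
    by (rule has_bochner_integral_mono[OF mix has_bochner_integral_mult_right[OF mix]])
      (auto intro: cut_inequality_real[OF cut])
qed

text \<open>The right side is the number of ones among the four values if c = 0, and the number of
  zeros if c = 1.\<close>

lemma cut_corner:
  fixes p q r s c :: real
  assumes "p \<in> {0, 1}" "q \<in> {0, 1}" "r \<in> {0, 1}" "s \<in> {0, 1}" "c \<in> {0, 1}"
  shows "min (p + q + (r + s)) (4 - (p + q + (r + s)))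
    \<le> \<bar>c - p\<bar> + \<bar>c - q\<bar> + \<bar>c - r\<bar> + \<bar>c - s\<bar>"
  using assms by auto

text \<open>A separated pair has a one on one side and a zero on the other; p + q and r + s count
  the ones.\<close>

lemma cut_cross:
  fixes p q r s :: real
  assumes "p \<in> {0, 1}" "q \<in> {0, 1}" "r \<in> {0, 1}" "s \<in> {0, 1}"
  shows "\<bar>p - r\<bar> + \<bar>p - s\<bar> + \<bar>q - r\<bar> + \<bar>q - s\<bar>
    = (p + q) * (2 - (r + s)) + (r + s) * (2 - (p + q))"
  using assms by auto

lemma cut_pair:
  fixes p q :: real
  assumes "p \<in> {0, 1}" "q \<in> {0, 1}"
  shows "\<bar>p - q\<bar> = (p + q) * (2 - (p + q))"
  using assms by auto

text \<open>The corner c_i lies between copies i - 1 and i (mod 4), whose middle vertices are l_i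
  and r_i. The left side is the cut of two complete graphs on four vertices, each formed by the
  middle vertices of two opposite copies. With a_i = l_i + r_i it equals A (4 - A) + B (4 - B) for A
  = a_0 + a_2 and B = a_1 + a_3, so 81 cases remain.\<close>

lemma cut_cycle:
  fixes c0 c1 c2 c3 l0 l1 l2 l3 r0 r1 r2 r3 :: real
  assumes c: "c0 \<in> {0, 1}" "c1 \<in> {0, 1}" "c2 \<in> {0, 1}" "c3 \<in> {0, 1}"
    and l: "l0 \<in> {0, 1}" "l1 \<in> {0, 1}" "l2 \<in> {0, 1}" "l3 \<in> {0, 1}"
    and r: "r0 \<in> {0, 1}" "r1 \<in> {0, 1}" "r2 \<in> {0, 1}" "r3 \<in> {0, 1}"
  shows "\<bar>l0 - r0\<bar> + \<bar>l1 - r1\<bar> + \<bar>l2 - r2\<bar> + \<bar>l3 - r3\<bar>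
      + (\<bar>l0 - l2\<bar> + \<bar>l0 - r2\<bar> + \<bar>r0 - l2\<bar> + \<bar>r0 - r2\<bar>)
      + (\<bar>l1 - l3\<bar> + \<bar>l1 - r3\<bar> + \<bar>r1 - l3\<bar> + \<bar>r1 - r3\<bar>)
    \<le> 2 * ((\<bar>c0 - l3\<bar> + \<bar>c0 - r3\<bar> + \<bar>c0 - l0\<bar> + \<bar>c0 - r0\<bar>)
      + (\<bar>c1 - l0\<bar> + \<bar>c1 - r0\<bar> + \<bar>c1 - l1\<bar> + \<bar>c1 - r1\<bar>)
      + (\<bar>c2 - l1\<bar> + \<bar>c2 - r1\<bar> + \<bar>c2 - l2\<bar> + \<bar>c2 - r2\<bar>)
      + (\<bar>c3 - l2\<bar> + \<bar>c3 - r2\<bar> + \<bar>c3 - l3\<bar> + \<bar>c3 - r3\<bar>))"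
    (is "?lhs \<le> ?rhs")
proof -
  define m :: "real \<Rightarrow> real \<Rightarrow> real" where "m a b = min (a + b) (4 - (a + b))" for a b
  \<comment> \<open>A cut enters only through the numbers \<open>a\<^sub>i = l\<^sub>i + r\<^sub>i\<close>: each corner sees four middle
    vertices, and may be assumed to lie on the side of their majority.\<close>
  have key: "a0 * (2 - a0) + a1 * (2 - a1) + a2 * (2 - a2) + a3 * (2 - a3)
      + (a0 * (2 - a2) + a2 * (2 - a0)) + (a1 * (2 - a3) + a3 * (2 - a1))
      \<le> 2 * (m a3 a0 + m a0 a1 + m a1 a2 + m a2 a3)"
    if "a0 \<in> {0, 1, 2}" "a1 \<in> {0, 1, 2}" "a2 \<in> {0, 1, 2}" "a3 \<in> {0, 1, 2}"
    for a0 a1 a2 a3 :: real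
    using that unfolding m_def by (elim insertE emptyE) simp_all
  have sum: "l + r \<in> {0, 1, 2}" if "l \<in> {0, 1}" "r \<in> {0, 1}" for l r :: real
    using that by auto
  have "?lhs \<le> 2 * (m (l3 + r3) (l0 + r0) + m (l0 + r0) (l1 + r1)
      + m (l1 + r1) (l2 + r2) + m (l2 + r2) (l3 + r3))"
    unfolding cut_pair[OF l(1) r(1)] cut_pair[OF l(2) r(2)] cut_pair[OF l(3) r(3)]
      cut_pair[OF l(4) r(4)] cut_cross[OF l(1) r(1) l(3) r(3)] cut_cross[OF l(2) r(2) l(4) r(4)]
    by (intro key sum l r)
  also have "\<dots> \<le> ?rhs"
    unfolding m_def
    by (intro mult_left_mono add_mono cut_corner c l r) simp
  finally show ?thesis .
qed

subsection \<open>Distances in the Laakso graph\<close>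

lemma laakso2_dist_walk:
  assumes "a \<in> laakso2_verts" "b \<in> laakso2_verts"
  shows "(a, b) \<in> laakso2_adj ^^ laakso2_dist a b"
  unfolding laakso2_dist_def using laakso2_connected[OF assms] by (rule LeastI_ex)

lemma laakso2_dist_arc:
  assumes "(a, b) \<in> laakso2_arcs"
  shows "laakso2_dist a b \<le> 1"
  unfolding laakso2_dist_def
  by (rule Least_le) (use assms in \<open>simp add: laakso2_adj_def\<close>)

lemma laakso2_dist_ge_2:
  assumes "a \<in> laakso2_verts" "b \<in> laakso2_verts" "a \<noteq> b" "(a, b) \<notin> laakso2_adj"
  shows "2 \<le> laakso2_dist a b"
proof (rule ccontr)
  assume "\<not> 2 \<le> laakso2_dist a b"
  then consider "laakso2_dist a b = 0" | "laakso2_dist a b = 1"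
    by linarith
  then show False
    using laakso2_dist_walk[OF assms(1,2)] assms(3,4) by cases auto
qed

text \<open>Along a walk h changes by at most 1 per edge, so a suitable h certifies a lower bound on
  distance.\<close>

lemma laakso2_dist_lipschitz:
  fixes h :: "laakso2 \<Rightarrow> int"
  assumes "\<And>u v. (u, v) \<in> laakso2_arcs \<Longrightarrow> \<bar>h u - h v\<bar> \<le> 1"
    and "a \<in> laakso2_verts" "b \<in> laakso2_verts"
  shows "\<bar>h a - h b\<bar> \<le> int (laakso2_dist a b)"
proof -
  have "\<bar>h u - h v\<bar> \<le> int n" if "(u, v) \<in> laakso2_adj ^^ n" for u v n
    using that
  proof (induction n arbitrary: v)
    case (Suc n)
    then obtain w where "(u, w) \<in> laakso2_adj ^^ n" "(w, v) \<in> laakso2_adj"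
      by auto
    moreover from this have "\<bar>h w - h v\<bar> \<le> 1"
      using assms(1)[of w v] assms(1)[of v w] by (auto simp: laakso2_adj_def)
    ultimately show ?case using Suc.IH[of w] by linarith
  qed simp
  then show ?thesis using laakso2_dist_walk[OF assms(2,3)] .
qed

text \<open>The distance to the middle vertices of the copy replacing \<open>(VT, s)\<close>, for
  \<open>s \<in> {VL, VR}\<close>, except that it is cut off to a constant on the two pendant copies.\<close>

fun potential :: "laakso1 \<Rightarrow> laakso2 \<Rightarrow> int" where
  "potential s (Old u) = (if u \<in> {VA, VT, s} then 2 else 6)"
| "potential s (New (u, v) w) =
    (if u = VA then 2 else if u = VB then 6
     else if (u, v) = (VT, s) then (if w \<in> {VL, VR} then 0 else 1)
     else if u \<in> {VT, s} then (if w = VT then 3 else if w = VB then 5 else 4)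
     else (if w \<in> {VL, VR} then 8 else 7))"

lemma potential_lipschitz:
  assumes "s \<in> {VL, VR}" "(a, b) \<in> laakso2_arcs"
  shows "\<bar>potential s a - potential s b\<bar> \<le> 1"
  using assms by (auto simp: laakso2_arcs_def laakso1_arcs_def)

lemma New_in_laakso2_verts:
  assumes "e \<in> laakso1_arcs" "w \<notin> {VA, VU}"
  shows "New e w \<in> laakso2_verts"
proof -
  have "New e w = in_copy e w"
    using assms(2) by (cases e; cases w) auto
  then show ?thesis using assms(1) by (auto simp: laakso2_verts_def)
qed

lemma laakso2_dist_middle:
  assumes "e \<in> laakso1_arcs"
  shows "2 \<le> laakso2_dist (New e VL) (New e VR)"
proof (rule laakso2_dist_ge_2)
  show "(New e VL, New e VR) \<notin> laakso2_adj"
    by (auto simp: laakso2_adj_def laakso2_arcs_def laakso1_arcs_def)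
qed (use assms in \<open>auto intro: New_in_laakso2_verts\<close>)

text \<open>\<open>potential s\<close> is 0 at the first vertex and 8 at the second.\<close>

lemma laakso2_dist_antipodal:
  assumes "(s, s') \<in> {(VL, VR), (VR, VL)}" "w \<in> {VL, VR}" "w' \<in> {VL, VR}"
  shows "8 \<le> laakso2_dist (New (VT, s) w) (New (s', VB) w')"
proof -
  have "\<bar>potential s (New (VT, s) w) - potential s (New (s', VB) w')\<bar>
      \<le> int (laakso2_dist (New (VT, s) w) (New (s', VB) w'))"
    using assms
    by (intro laakso2_dist_lipschitz potential_lipschitz New_in_laakso2_verts)
      (auto simp: laakso1_arcs_def)
  then show ?thesis using assms by auto
qed

subsection \<open>The distortion bound\<close>

text \<open>Listed in cyclic order, matching the indices in \<open>cut_cycle\<close>, but each pair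
  is oriented as in \<open>laakso1_arcs\<close>.\<close>

definition sides :: "(laakso1 \<times> laakso1) list" where
  "sides = [(VT, VL), (VL, VB), (VR, VB), (VT, VR)]"

definition far_pairs :: "(laakso2 \<times> laakso2) list" where
  "far_pairs = [(New (VT, s) w, New (s', VB) w').
     (s, s') \<leftarrow> [(VL, VR), (VR, VL)], w \<leftarrow> [VL, VR], w' \<leftarrow> [VL, VR]]"

definition middle_pairs :: "(laakso2 \<times> laakso2) list" where
  "middle_pairs = [(New e VL, New e VR). e \<leftarrow> sides]"

text \<open>Weights are encoded as repetitions in the list.\<close>

definition weighted_arcs :: "(laakso2 \<times> laakso2) list" where
  "weighted_arcs = [(in_copy e p, in_copy e q). e \<leftarrow> sides,
     (p, q) \<leftarrow> [(VA, VT), (VA, VT), (VT, VL), (VT, VR), (VL, VB), (VR, VB), (VB, VU), (VB, VU)]]"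

lemma sides_arcs: "set sides \<subseteq> laakso1_arcs"
  by (auto simp: sides_def laakso1_arcs_def)

lemma weighted_arcs_arcs: "set weighted_arcs \<subseteq> laakso2_arcs"
  by (simp add: weighted_arcs_def sides_def laakso2_arcs_def laakso1_arcs_def)

lemma cut_inequality_laakso2:
  fixes s :: "laakso2 \<Rightarrow> real"
  assumes s: "\<And>v. s v \<in> {0, 1}"
  shows "(\<Sum>(a, b)\<leftarrow>middle_pairs @ far_pairs. \<bar>s a - s b\<bar>)
    \<le> 2 * (\<Sum>(a, b)\<leftarrow>weighted_arcs. \<bar>s a - s b\<bar>)"
proof -
  define d where "d a b = \<bar>s a - s b\<bar>" for a b
  have d_commute: "d a b = d b a" for a b
    by (simp add: d_def abs_minus_commute)
  have triangle: "d a c \<le> d a b + d b c" for a b c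
    unfolding d_def by linarith
  \<comment> \<open>Both paths from the corner c to l and r run through t, hence the weight 2 of the
    edge from c to t.\<close>
  have stem: "d c l + d c r \<le> 2 * d c t + d t l + d t r" for c l r t
    using triangle[of c l t] triangle[of c r t] by linarith
  have copy: "d (Old u) (New (u, v) VL) + d (Old u) (New (u, v) VR)
      + d (Old v) (New (u, v) VL) + d (Old v) (New (u, v) VR)
    \<le> (\<Sum>(p, q)\<leftarrow>[(VA, VT), (VA, VT), (VT, VL), (VT, VR), (VL, VB), (VR, VB), (VB, VU), (VB, VU)].
        d (in_copy (u, v) p) (in_copy (u, v) q))" for u v
    using stem[of "Old u" "New (u, v) VL" "New (u, v) VR" "New (u, v) VT"]
      stem[of "Old v" "New (u, v) VL" "New (u, v) VR" "New (u, v) VB"]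
    by (simp add: d_commute)
  note cycle = cut_cycle[of "s (Old VT)" "s (Old VL)" "s (Old VB)" "s (Old VR)"
      "s (New (VT, VL) VL)" "s (New (VL, VB) VL)" "s (New (VR, VB) VL)" "s (New (VT, VR) VL)"
      "s (New (VT, VL) VR)" "s (New (VL, VB) VR)" "s (New (VR, VB) VR)" "s (New (VT, VR) VR)",
      OF s s s s s s s s s s s s, folded d_def]
  have "(\<Sum>(a, b)\<leftarrow>weighted_arcs. d a b)
    = (\<Sum>(u, v)\<leftarrow>sides. \<Sum>(p, q)\<leftarrow>[(VA, VT), (VA, VT), (VT, VL), (VT, VR), (VL, VB), (VR, VB), (VB, VU), (VB, VU)].
        d (in_copy (u, v) p) (in_copy (u, v) q))"
    by (simp add: weighted_arcs_def sides_def)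
  also have "\<dots> \<ge> (\<Sum>(u, v)\<leftarrow>sides. d (Old u) (New (u, v) VL) + d (Old u) (New (u, v) VR)
      + d (Old v) (New (u, v) VL) + d (Old v) (New (u, v) VR))"
    by (rule sum_list_mono) (use copy in auto)
  finally have arcs: "(\<Sum>(u, v)\<leftarrow>sides. d (Old u) (New (u, v) VL) + d (Old u) (New (u, v) VR)
      + d (Old v) (New (u, v) VL) + d (Old v) (New (u, v) VR)) \<le> (\<Sum>(a, b)\<leftarrow>weighted_arcs. d a b)" .
  have "(\<Sum>(a, b)\<leftarrow>middle_pairs @ far_pairs. d a b)
    \<le> 2 * (\<Sum>(u, v)\<leftarrow>sides. d (Old u) (New (u, v) VL) + d (Old u) (New (u, v) VR)
      + d (Old v) (New (u, v) VL) + d (Old v) (New (u, v) VR))"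
    using cycle by (simp add: middle_pairs_def far_pairs_def sides_def d_commute)
  then have "(\<Sum>(a, b)\<leftarrow>middle_pairs @ far_pairs. d a b) \<le> 2 * (\<Sum>(a, b)\<leftarrow>weighted_arcs. d a b)"
    using arcs by linarith
  then show ?thesis by (simp add: d_def)
qed

theorem theorem11:
  fixes c :: real and f :: "laakso2 \<Rightarrow> real \<Rightarrow> real"
  assumes "\<And>a. a \<in> laakso2_verts \<Longrightarrow> f a \<in> L1_unit"
    and "\<And>a b. a \<in> laakso2_verts \<Longrightarrow> b \<in> laakso2_verts \<Longrightarrow>
      real (laakso2_dist a b) \<le> L1_norm (\<lambda>x. f a x - f b x) \<and>
      L1_norm (\<lambda>x. f a x - f b x) \<le> c * real (laakso2_dist a b)"
  shows "c \<ge> 9 / 8"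
proof -
  let ?d = "\<lambda>(a, b). L1_norm (\<lambda>x. f a x - f b x)"
  have arc_verts: "a \<in> laakso2_verts \<and> b \<in> laakso2_verts" if "(a, b) \<in> laakso2_arcs" for a b
    using that by (auto simp: laakso2_arcs_def laakso2_verts_def)
  have middle: "a \<in> laakso2_verts \<and> b \<in> laakso2_verts \<and> 2 \<le> laakso2_dist a b"
    if "(a, b) \<in> set middle_pairs" for a b
    using that sides_arcs laakso2_dist_middle
    by (auto simp: middle_pairs_def intro: New_in_laakso2_verts)
  have far: "a \<in> laakso2_verts \<and> b \<in> laakso2_verts \<and> 8 \<le> laakso2_dist a b"
    if "(a, b) \<in> set far_pairs" for a b
    using that
    by (auto simp: far_pairs_def laakso1_arcs_def intro!: New_in_laakso2_verts laakso2_dist_antipodal)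
  \<comment> \<open>The sign matters below: an arc is only known to have \<open>laakso2_dist\<close>
    at most 1, and \<open>c * laakso2_dist\<close> is then bounded by c. Any pair at positive
    distance yields it.\<close>
  have "0 \<le> c"
  proof -
    let ?a = "New (VT, VL) VL" and ?b = "New (VT, VL) VR"
    have ab: "?a \<in> laakso2_verts \<and> ?b \<in> laakso2_verts \<and> 2 \<le> laakso2_dist ?a ?b"
      by (rule middle) (simp add: middle_pairs_def sides_def)
    then have "real (laakso2_dist ?a ?b) \<le> c * real (laakso2_dist ?a ?b)"
      using assms(2)[of ?a ?b] by linarith
    then show ?thesis
      using ab by (simp add: mult_le_cancel_right1)
  qed
  have lower: "real n * real (length ps) \<le> (\<Sum>p\<leftarrow>ps. ?d p)"
    if "\<And>a b. (a, b) \<in> set ps \<Longrightarrow>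
      a \<in> laakso2_verts \<and> b \<in> laakso2_verts \<and> n \<le> laakso2_dist a b" for n ps
  proof -
    have "(\<Sum>p\<leftarrow>ps. real n) \<le> (\<Sum>p\<leftarrow>ps. ?d p)"
    proof (rule sum_list_mono)
      fix p assume "p \<in> set ps"
      moreover obtain a b where p: "p = (a, b)"
        by (cases p)
      ultimately show "real n \<le> ?d p"
        using that[of a b] assms(2)[of a b] by simp
    qed
    then show ?thesis by (simp add: sum_list_triv mult.commute)
  qed
  have "(\<Sum>p\<leftarrow>weighted_arcs. ?d p) \<le> (\<Sum>p\<leftarrow>weighted_arcs. c)"
  proof (rule sum_list_mono)
    fix p assume "p \<in> set weighted_arcs"
    then obtain a b where p: "p = (a, b)" and arc: "(a, b) \<in> laakso2_arcs"
      using weighted_arcs_arcs by (metis subsetD surj_pair)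
    have "?d p \<le> c * real (laakso2_dist a b)"
      using arc_verts[OF arc] assms(2) by (simp add: p)
    also have "\<dots> \<le> c"
      using laakso2_dist_arc[OF arc] \<open>0 \<le> c\<close> by (simp add: mult_left_le)
    finally show "?d p \<le> c" .
  qed
  \<comment> \<open>Four copies contribute eight arcs each, counted with multiplicity.\<close>
  also have "\<dots> = 32 * c"
    by (simp add: weighted_arcs_def sides_def)
  finally have upper: "(\<Sum>p\<leftarrow>weighted_arcs. ?d p) \<le> 32 * c" .
  have len: "length middle_pairs = 4" "length far_pairs = 8"
    by (simp_all add: middle_pairs_def far_pairs_def sides_def)
  have "(\<Sum>p\<leftarrow>middle_pairs @ far_pairs. ?d p) \<le> 2 * (\<Sum>p\<leftarrow>weighted_arcs. ?d p)"
  proof (rule cut_inequality_L1[OF cut_inequality_laakso2])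
    fix a b assume "(a, b) \<in> set (middle_pairs @ far_pairs) \<union> set weighted_arcs"
    then have "a \<in> laakso2_verts \<and> b \<in> laakso2_verts"
      using middle far arc_verts weighted_arcs_arcs by auto
    then show "f a \<in> L1_unit \<and> f b \<in> L1_unit"
      using assms(1) by blast
  qed
  moreover have "8 \<le> (\<Sum>p\<leftarrow>middle_pairs. ?d p)"
    using lower[OF middle, of middle_pairs] len by simp
  moreover have "64 \<le> (\<Sum>p\<leftarrow>far_pairs. ?d p)"
    using lower[OF far, of far_pairs] len by simp
  ultimately have "72 \<le> 64 * c"
    using upper by simp
  then show ?thesis by simp
qed

end
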